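(* Every $P$-space of weight $\omega_1$ is homeomorphic to a subspace of $(2^{\omega_1})_\delta$.
   Context: A $P$-space is a completely regular $T_1$-space in which every countable intersection of open sets is open. The weight of a space is the least cardinality of a base. For a $T_1$-space $X$, the $G_\delta$-modification $(X)_\delta$ is the set $X$ endowed with the topology generated by all $G_\delta$-subsets of $X$. $2^{\omega_1}=\{0,1\}^{\omega_1}$ carries the product topology ($\{0,1\}$ discrete), and $(2^{\omega_1})_\delta$ is its $G_\delta$-modification; a base consists of the sets $[f]=\{g\in 2^{\omega_1}: f\subseteq g\}$ with $f\in 2^\alpha$, $\alpha<\omega_1$. *)

theory Defs
  imports "HOL-Analysis.Analysis"
begin

unbundle cardinal_syntax
no_notation elt_set_eq (infix "=o" 50)

definition base_of :: "'a topology \<Rightarrow> 'a set set \<Rightarrow> bool" where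
  "base_of X \<B> \<longleftrightarrow> (\<forall>V \<in> \<B>. openin X V) \<and>
     (\<forall>U x. openin X U \<and> x \<in> U \<longrightarrow> (\<exists>V \<in> \<B>. x \<in> V \<and> V \<subseteq> U))"

text \<open>Cardinals are cardinal well-orders, compared up to isomorphism across types, so the
  weight is given as a relation between spaces and cardinals.\<close>

definition has_weight :: "'a topology \<Rightarrow> 'b rel \<Rightarrow> bool" where
  "has_weight X \<kappa> \<longleftrightarrow> (\<exists>\<B>. base_of X \<B> \<and> |\<B>| =o \<kappa>) \<and> (\<forall>\<B>. base_of X \<B> \<longrightarrow> \<kappa> \<le>o |\<B>| )"

text \<open>The family is required to be nonempty because the empty intersection is the whole type,
  which need not be the whole space.\<close>

definition P_space :: "'a topology \<Rightarrow> bool" where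
  "P_space X \<longleftrightarrow> completely_regular_space X \<and> t1_space X \<and>
     (\<forall>\<U>. countable \<U> \<and> \<U> \<noteq> {} \<and> (\<forall>U \<in> \<U>. openin X U) \<longrightarrow> openin X (\<Inter>\<U>))"

definition gdelta_modification :: "'a topology \<Rightarrow> 'a topology" where
  "gdelta_modification X = topology_generated_by {S. gdelta_in X S}"

definition omega1 :: "nat set rel" where
  "omega1 = cardSuc natLeq"

definition cantor_cube_omega1 :: "(nat set \<Rightarrow> nat) topology" where
  "cantor_cube_omega1 = product_topology (\<lambda>_. discrete_topology {0, 1}) (Field omega1)"

lemma topspace_gdelta_modification [simp]: "topspace (gdelta_modification X) = topspace X"
proof -
  have "gdelta_in X (topspace X)"
    by (simp add: open_imp_gdelta_in)
  moreover have "S \<subseteq> topspace X" if "gdelta_in X S" for S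
    using that by (rule gdelta_in_subset)
  ultimately show ?thesis
    unfolding gdelta_modification_def topology_generated_by_topspace by blast
qed

lemma Card_order_omega1: "Card_order omega1"
  unfolding omega1_def by (rule cardSuc_Card_order[OF natLeq_Card_order])

lemma has_weight_exists: "\<exists>\<kappa> :: 'a set rel. has_weight X \<kappa>" for X :: "'a topology"
proof -
  let ?R = "{|\<B>| | \<B>. base_of X \<B>}"
  have "base_of X {U. openin X U}"
    unfolding base_of_def by auto
  then have "?R \<noteq> {}" by blast
  moreover have "\<forall>r \<in> ?R. Card_order r"
    using card_of_Card_order by blast
  ultimately obtain r where "r \<in> ?R" "\<forall>r' \<in> ?R. r \<le>o r'"
    using exists_minim_Card_order by meson
  then show ?thesis
    unfolding has_weight_def using card_of_refl by blast
qed

lemma has_weight_unique: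
  assumes "has_weight X \<kappa>" "has_weight X \<mu>"
  shows "\<kappa> =o \<mu>"
  using assms unfolding has_weight_def
  by (meson ordIso_iff_ordLeq ordIso_symmetric ordLeq_ordIso_trans)

end

theory Submission
  imports Defs
begin

text \<open>In a P-space zero sets are clopen, so complete regularity makes the clopen sets a base.
  Choosing one clopen set between each suitable pair of members of a base of size \<open>\<omega>\<^sub>1\<close> gives a
  clopen base indexed by \<open>\<omega>\<^sub>1\<close>. The map sending a point to the sequence of its memberships in
  these clopen sets is an embedding into the cube; it stays continuous for the finer
  \<open>G\<^sub>\<delta>\<close>-topology because preimages of \<open>G\<^sub>\<delta>\<close>-sets are \<open>G\<^sub>\<delta>\<close>, hence open.\<close>

lemma gdelta_in_continuous_map_preimage:
  assumes f: "continuous_map X Y f" and S: "gdelta_in Y S"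
  shows "gdelta_in X {x \<in> topspace X. f x \<in> S}"
proof -
  obtain D :: "nat \<Rightarrow> _" where D: "\<And>n. openin Y (D n)" "\<Inter>(range D) = S"
    using S unfolding gdelta_in_descending by blast
  have eq: "{x \<in> topspace X. f x \<in> S} = \<Inter>(range (\<lambda>n. {x \<in> topspace X. f x \<in> D n}))"
    using D(2) by auto
  have "gdelta_in X {x \<in> topspace X. f x \<in> D n}" for n
    using f D(1) by (intro open_imp_gdelta_in openin_continuous_map_preimage)
  then show ?thesis
    unfolding eq by (intro gdelta_in_Inter) auto
qed

lemma P_space_gdelta_imp_openin:
  assumes X: "P_space X" and S: "gdelta_in X S"
  shows "openin X S"
proof -
  obtain D :: "nat \<Rightarrow> _" where D: "\<And>n. openin X (D n)" "\<Inter>(range D) = S"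
    using S unfolding gdelta_in_descending by blast
  \<comment> \<open>A sequence of open sets always has nonempty range, as the intersection clause of
    \<open>P_space\<close> demands.\<close>
  have "countable (range D) \<and> range D \<noteq> {} \<and> (\<forall>U \<in> range D. openin X U)"
    using D(1) by auto
  then have "openin X (\<Inter>(range D))"
    using X unfolding P_space_def by blast
  then show ?thesis
    by (simp add: D(2))
qed

lemma continuous_map_gdelta_modification:
  assumes X: "P_space X" and f: "continuous_map X Y f"
  shows "continuous_map X (gdelta_modification Y) f"
  unfolding gdelta_modification_def
proof (rule continuous_on_generated_topo)
  fix S assume "S \<in> {S. gdelta_in Y S}"
  then have "openin X {x \<in> topspace X. f x \<in> S}"
    using P_space_gdelta_imp_openin[OF X] gdelta_in_continuous_map_preimage[OF f] by blast
  moreover have "f -` S \<inter> topspace X = {x \<in> topspace X. f x \<in> S}"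
    by auto
  ultimately show "openin X (f -` S \<inter> topspace X)"
    by simp
next
  \<comment> \<open>The generators must also cover the image of \<open>f\<close>; they do, since
    \<open>topspace Y\<close> is itself a G-delta set.\<close>
  have "f ` topspace X \<subseteq> topspace Y"
    using f by (simp add: continuous_map_image_subset_topspace)
  then show "f ` topspace X \<subseteq> \<Union>{S. gdelta_in Y S}"
    by blast
qed

text \<open>Complete regularity gives a real function that is 0 at \<open>x\<close> and 1 off
  \<open>U\<close>. Its zero set is closed by continuity, and open because {0} is a G-delta set in
  the reals.\<close>

lemma P_space_clopen_between:
  assumes X: "P_space X" and U: "openin X U" and x: "x \<in> U"
  obtains C where "openin X C" "closedin X C" "x \<in> C" "C \<subseteq> U"
proof -
  have "closedin X (topspace X - U)" "x \<in> topspace X - (topspace X - U)"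
    using U x openin_subset by auto
  moreover have "completely_regular_space X"
    using X by (simp add: P_space_def)
  ultimately obtain f :: "_ \<Rightarrow> real" where f: "continuous_map X (top_of_set {0..1}) f" "f x = 0"
      "f ` (topspace X - U) \<subseteq> {1}"
    unfolding completely_regular_space_def by metis
  have fr: "continuous_map X euclideanreal f"
    using f(1) by (simp add: continuous_map_in_subtopology)
  let ?C = "{y \<in> topspace X. f y \<in> {0}}"
  show thesis
  proof
    have "gdelta_in euclideanreal {0::real}"
      by (simp add: closed_imp_gdelta_in metrizable_space_euclidean)
    then show "openin X ?C"
      using P_space_gdelta_imp_openin[OF X] gdelta_in_continuous_map_preimage[OF fr] by blast
    show "closedin X ?C"
      using fr by (rule closedin_continuous_map_preimage) simp
    show "x \<in> ?C"
      using U x f(2) openin_subset by auto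
    show "?C \<subseteq> U"
      using f(3) by fastforce
  qed
qed

text \<open>Clopenness makes each membership coordinate continuous; the base property gives
  injectivity (with T1) and openness onto the image.\<close>

lemma P_space_homeomorphic_subspace_cube:
  fixes X :: "'a topology" and I :: "'i set"
  assumes X: "P_space X"
    and clopen: "\<And>i. i \<in> I \<Longrightarrow> openin X (C i) \<and> closedin X (C i)"
    and base: "\<And>U x. openin X U \<Longrightarrow> x \<in> U \<Longrightarrow> \<exists>i\<in>I. x \<in> C i \<and> C i \<subseteq> U"
  defines "Q \<equiv> product_topology (\<lambda>_. discrete_topology {0, 1::nat}) I"
  shows "\<exists>S \<subseteq> topspace (gdelta_modification Q).
           X homeomorphic_space subtopology (gdelta_modification Q) S"
proof -
  \<comment> \<open>Restricting to \<open>I\<close> makes \<open>e x\<close> extensional, as points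
    of the product topology must be.\<close>
  define e where "e x = (\<lambda>i\<in>I. if x \<in> C i then 1 else 0 :: nat)" for x
  let ?S = "e ` topspace X"
  let ?Y = "gdelta_modification Q"
  have "continuous_map X (discrete_topology {0, 1}) (\<lambda>x. e x i)" if i: "i \<in> I" for i
    unfolding continuous_map_def
  proof (intro conjI allI impI)
    show "(\<lambda>x. e x i) \<in> topspace X \<rightarrow> topspace (discrete_topology {0, 1})"
      using i by (auto simp: e_def)
    fix V :: "nat set"
    have "C i \<subseteq> topspace X"
      using clopen[OF i] openin_subset by blast
    \<comment> \<open>The fibres over 1 and 0 are \<open>C i\<close> and its complement, both
      open.\<close>
    then have "{x \<in> topspace X. e x i \<in> V} =
        (if 1 \<in> V then C i else {}) \<union> (if 0 \<in> V then topspace X - C i else {})"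
      using i by (auto simp: e_def)
    moreover have "openin X (topspace X - C i)"
      using clopen[OF i] by blast
    ultimately show "openin X {x \<in> topspace X. e x i \<in> V}"
      using clopen[OF i] by (simp add: openin_Un)
  qed
  then have "continuous_map X Q e"
    unfolding Q_def continuous_map_componentwise by (auto simp: e_def)
  then have cont: "continuous_map X ?Y e"
    by (rule continuous_map_gdelta_modification[OF X])
  have inj: "inj_on e (topspace X)"
  proof (rule inj_onI, rule ccontr)
    fix x y assume xy: "x \<in> topspace X" "y \<in> topspace X" "e x = e y" "x \<noteq> y"
    then obtain U where "openin X U" "x \<in> U" "y \<notin> U"
      using X unfolding P_space_def t1_space_def by metis
    then obtain i where "i \<in> I" "x \<in> C i" "y \<notin> C i"
      using base by blast
    then have "e x i \<noteq> e y i"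
      by (simp add: e_def)
    with xy(3) show False
      by simp
  qed
  have "open_map X (subtopology ?Y ?S) e"
    unfolding open_map_def
  proof (intro allI impI)
    fix U assume U: "openin X U"
    show "openin (subtopology ?Y ?S) (e ` U)"
    proof (subst openin_subopen, intro ballI)
      fix z assume "z \<in> e ` U"
      then obtain x where x: "x \<in> U" "z = e x"
        by blast
      then obtain i where i: "i \<in> I" "x \<in> C i" "C i \<subseteq> U"
        using base U by blast
      \<comment> \<open>This subbasic set is open already in \<open>Q\<close>, and its trace on the
        image is exactly \<open>e\<close> C
        i\<open>, a neighbourhood of\<close>z\<open>inside\<close>e \<open>U\<close>.\<close>
      let ?T = "{g \<in> topspace Q. g i \<in> {1}}"
      have "continuous_map Q (discrete_topology {0, 1}) (\<lambda>g. g i)"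
        unfolding Q_def using i(1) by (rule continuous_map_product_projection)
      then have "openin Q ?T"
        by (rule openin_continuous_map_preimage) simp
      then have "openin ?Y ?T"
        unfolding gdelta_modification_def
        by (intro topology_generated_by_Basis) (simp add: open_imp_gdelta_in)
      then have "openin (subtopology ?Y ?S) (?S \<inter> ?T)"
        by (rule openin_subtopology_Int2)
      moreover have "z \<in> ?S \<inter> ?T"
        using U x i openin_subset[OF U] by (auto simp: e_def Q_def PiE_iff)
      moreover have "?S \<inter> ?T \<subseteq> e ` U"
        using i by (auto simp: e_def split: if_splits)
      ultimately show "\<exists>T. openin (subtopology ?Y ?S) T \<and> z \<in> T \<and> T \<subseteq> e ` U"
        by blast
    qed
  qed
  moreover have "continuous_map X (subtopology ?Y ?S) e"
    using cont by (simp add: continuous_map_in_subtopology)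
  ultimately have "embedding_map X (subtopology ?Y ?S) e"
    using inj by (intro injective_open_imp_embedding_map)
  then have "embedding_map X ?Y e"
    by (simp add: embedding_map_in_subtopology)
  then show ?thesis
    using embedding_map_imp_homeomorphic_space continuous_map_image_subset_topspace[OF cont]
    by blast
qed

text \<open>The clopen sets form a base that may be too large. One clopen set for each pair of
  members of \<open>\<B>\<close> that admits one in between suffices, and the pairs can be coded in
  \<open>I\<close> because \<open>I\<close> is infinite.\<close>

lemma P_space_indexed_clopen_base:
  assumes X: "P_space X" and \<B>: "base_of X \<B>" and I: "|\<B>| \<le>o |I|" and inf: "infinite I"
  obtains C where "\<And>i. i \<in> I \<Longrightarrow> openin X (C i) \<and> closedin X (C i)"
    and "\<And>U x. openin X U \<Longrightarrow> x \<in> U \<Longrightarrow> \<exists>i\<in>I. x \<in> C i \<and> C i \<subseteq> U"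
proof -
  define between where
    "between p D \<longleftrightarrow> openin X D \<and> closedin X D \<and> fst p \<subseteq> D \<and> D \<subseteq> snd p" for p D
  have "|\<B> \<times> \<B>| \<le>o |I|"
    using card_of_Times_mono1[OF I]
      ordLeq_ordIso_trans[OF card_of_Times_mono2[OF I] card_of_Times_same_infinite[OF inf]]
    by (rule ordLeq_transitive)
  then obtain h where h: "inj_on h (\<B> \<times> \<B>)" "h ` (\<B> \<times> \<B>) \<subseteq> I"
    by (metis card_of_ordLeq)
  \<comment> \<open>\<open>s\<close> decodes indices into pairs. Its values off the range of
    \<open>h\<close> are arbitrary, which is harmless: \<open>C i\<close> is either a chosen clopen
    set or the empty set, so it is clopen for every \<open>i\<close>.\<close>
  define s where "s = inv_into (\<B> \<times> \<B>) h"
  define C where "C i = (if \<exists>D. between (s i) D then SOME D. between (s i) D else {})" for i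
  have C: "between (s i) (C i)" if "between (s i) D" for i D
    using that unfolding C_def by (metis someI)
  show thesis
  proof
    show "openin X (C i) \<and> closedin X (C i)" for i
    proof (cases "\<exists>D. between (s i) D")
      case True
      then show ?thesis
        using C unfolding between_def by blast
    next
      case False
      then show ?thesis
        by (simp add: C_def)
    qed
    fix U x assume U: "openin X U" and x: "x \<in> U"
    obtain V where V: "V \<in> \<B>" "x \<in> V" "V \<subseteq> U"
      using \<B> U x unfolding base_of_def by blast
    moreover have "openin X V"
      using \<B> V(1) unfolding base_of_def by blast
    ultimately obtain D where D: "openin X D" "closedin X D" "x \<in> D" "D \<subseteq> V"
      using P_space_clopen_between[OF X] by metis
    \<comment> \<open>\<open>D\<close> witnesses that the pair \<open>(W, V)\<close> admits a clopen
      set in between. The chosen one may differ from \<open>D\<close>, but it still contains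
      \<open>W\<close>, hence \<open>x\<close>, and lies in \<open>V\<close>.\<close>
    obtain W where W: "W \<in> \<B>" "x \<in> W" "W \<subseteq> D"
      using \<B> D unfolding base_of_def by blast
    let ?i = "h (W, V)"
    have s: "s ?i = (W, V)"
      using h(1) V W by (simp add: s_def)
    then have "between (s ?i) D"
      using D W by (simp add: between_def)
    then have "between (s ?i) (C ?i)"
      by (rule C)
    then have "W \<subseteq> C ?i" "C ?i \<subseteq> V"
      by (simp_all add: between_def s)
    moreover have "?i \<in> I"
      using h(2) V W by blast
    ultimately show "\<exists>i\<in>I. x \<in> C i \<and> C i \<subseteq> U"
      using V W by blast
  qed
qed

theorem theorem18:
  fixes X :: "'a topology"
  assumes "P_space X" and "has_weight X omega1"
  shows "\<exists>S \<subseteq> topspace (gdelta_modification cantor_cube_omega1).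
           X homeomorphic_space subtopology (gdelta_modification cantor_cube_omega1) S"
proof -
  obtain \<B> where \<B>: "base_of X \<B>" "|\<B>| =o omega1"
    using assms(2) unfolding has_weight_def by blast
  \<comment> \<open>A cardinal order is isomorphic to the cardinality of its field, so the
    coordinates of the cube can index the clopen base.\<close>
  have "|\<B>| \<le>o |Field omega1|"
    using \<B>(2) ordIso_symmetric[OF card_of_Field_ordIso[OF Card_order_omega1]]
    by (rule ordIso_imp_ordLeq[OF ordIso_transitive])
  moreover have "infinite (Field omega1)"
    unfolding omega1_def using cardSuc_finite[OF natLeq_Card_order] by (simp add: Field_natLeq)
  ultimately obtain C where "\<And>i. i \<in> Field omega1 \<Longrightarrow> openin X (C i) \<and> closedin X (C i)"
    "\<And>U x. openin X U \<Longrightarrow> x \<in> U \<Longrightarrow> \<exists>i\<in>Field omega1. x \<in> C i \<and> C i \<subseteq> U"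
    using P_space_indexed_clopen_base[OF assms(1) \<B>(1)] by blast
  then show ?thesis
    unfolding cantor_cube_omega1_def by (rule P_space_homeomorphic_subspace_cube[OF assms(1)])
qed

end
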